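(* Let $f\in C^{1,1}_L(\mathbb{R}^d)$ be bounded below, let $\hat F:\mathbb{R}^+\to\mathbb{R}^+$ be smooth, strictly increasing with $\hat F'>0$, and concave, and let $\{x_k\}$, $\{r_k\}$ be generated by the gAEGD update rule. For any $\epsilon>0$ and $C>0$, define $$N_0=\max\left\{\frac{\ln(r_0/C)}{\ln(1+\underline{\alpha}\,\eta\,\epsilon)},\,1\right\},\qquad \underline{\alpha}=\frac{\bar F'}{\bar F}.$$ Then if $N\ge N_0$, at least one of the following holds: $$\min_{k\le N}\|\nabla f(x_k)\|^2<\epsilon\qquad\text{or}\qquad r_N\le C.$$
   Context: $\mathbb{R}^+=(0,\infty)$, $\|\cdot\|$ is the Euclidean norm, and $N$ denotes an integer. $C^{1,1}_L(\mathbb{R}^d)$ is the class of differentiable functions on $\mathbb{R}^d$ whose gradient is $L$-Lipschitz. Let $f^*=\inf_x f(x)$ and fix $c\in\mathbb{R}$ with $f^*+c>0$. The gAEGD update rule: given $x_0\in\mathbb{R}^d$, $r_0>0$ and $\eta>0$, for $k\ge 0$ put $F_k=\hat F(f(x_k)+c)$, $F'_k=\hat F'(f(x_k)+c)$, and $$r_{k+1}=\frac{r_k}{1+\eta\frac{F'_k}{F_k}\|\nabla f(x_k)\|^2},\qquad x_{k+1}=x_k-\eta\frac{r_{k+1}}{F_k}\nabla f(x_k).$$ Constants: $F^*=\hat F(f^*+c)$; $\bar F=F_0+\frac{L\eta r_0^2}{4F^*}$; $\bar f=\hat F^{-1}(\bar F)-c$; $\bar F'=\hat F'(\bar f+c)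$.
   Formalization: The formal statement adds the assumption that F̄ lies in the range of F̂, so that f̄ = F̂⁻¹(F̄) − c is defined; without it N_0 can be undefined, e.g. for the bounded function F̂(y) = y/(1+y) with a large step size η. *)

theory Defs
  imports "HOL-Analysis.Analysis"
begin

definition grad :: "('a::real_inner \<Rightarrow> real) \<Rightarrow> 'a \<Rightarrow> 'a" where
  "grad f x = (THE D. GDERIV f x :> D)"

definition C11 :: "real \<Rightarrow> ('a::euclidean_space \<Rightarrow> real) \<Rightarrow> bool" where
  "C11 L f \<longleftrightarrow> (\<forall>x. f differentiable (at x)) \<and> L-lipschitz_on UNIV (grad f)"

text \<open>Infinite differentiability on an open subset of the line. The function is total, but
  only its values on \<open>S\<close> matter: for \<open>S\<close> open, \<open>deriv\<close> at a point of \<open>S\<close> depends only on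
  values in \<open>S\<close>.\<close>

definition smooth_on_open :: "real set \<Rightarrow> (real \<Rightarrow> real) \<Rightarrow> bool" where
  "smooth_on_open S g \<longleftrightarrow> open S \<and> (\<forall>n. ((deriv ^^ n) g) differentiable_on S)"

text \<open>In all of the following, \<open>Fh\<close> represents a function from \<open>{0<..}\<close> to \<open>{0<..}\<close>;
  its values elsewhere are irrelevant.\<close>

definition gAEGD ::
  "('a::euclidean_space \<Rightarrow> real) \<Rightarrow> (real \<Rightarrow> real) \<Rightarrow> real \<Rightarrow> real \<Rightarrow> 'a \<Rightarrow> real \<Rightarrow>
   (nat \<Rightarrow> 'a) \<Rightarrow> (nat \<Rightarrow> real) \<Rightarrow> bool" where
  "gAEGD f Fh c \<eta> x0 r0 x r \<longleftrightarrow>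
     x 0 = x0 \<and> r 0 = r0 \<and>
     (\<forall>k. r (Suc k) =
            r k / (1 + \<eta> * (deriv Fh (f (x k) + c) / Fh (f (x k) + c)) * (norm (grad f (x k)))\<^sup>2)) \<and>
     (\<forall>k. x (Suc k) =
            x k - (\<eta> * (r (Suc k) / Fh (f (x k) + c))) *\<^sub>R grad f (x k))"

definition fstar :: "('a \<Rightarrow> real) \<Rightarrow> real" where
  "fstar f = (INF x. f x)"

definition Fstar :: "('a \<Rightarrow> real) \<Rightarrow> (real \<Rightarrow> real) \<Rightarrow> real \<Rightarrow> real" where
  "Fstar f Fh c = Fh (fstar f + c)"

definition Fbar ::
  "('a \<Rightarrow> real) \<Rightarrow> (real \<Rightarrow> real) \<Rightarrow> real \<Rightarrow> real \<Rightarrow> real \<Rightarrow> 'a \<Rightarrow> real \<Rightarrow> real" where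
  "Fbar f Fh c L \<eta> x0 r0 = Fh (f x0 + c) + L * \<eta> * r0\<^sup>2 / (4 * Fstar f Fh c)"

text \<open>The inverse of \<open>Fh\<close> is taken on \<open>{0<..}\<close>, so \<open>fbar\<close> is only meaningful when
  \<open>Fbar f Fh c L \<eta> x0 r0 \<in> Fh ` {0<..}\<close>. This is not automatic, since \<open>Fh\<close> may be bounded.\<close>

definition fbar ::
  "('a \<Rightarrow> real) \<Rightarrow> (real \<Rightarrow> real) \<Rightarrow> real \<Rightarrow> real \<Rightarrow> real \<Rightarrow> 'a \<Rightarrow> real \<Rightarrow> real" where
  "fbar f Fh c L \<eta> x0 r0 = the_inv_into {0<..} Fh (Fbar f Fh c L \<eta> x0 r0) - c"

definition Fbar' ::
  "('a \<Rightarrow> real) \<Rightarrow> (real \<Rightarrow> real) \<Rightarrow> real \<Rightarrow> real \<Rightarrow> real \<Rightarrow> 'a \<Rightarrow> real \<Rightarrow> real" where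
  "Fbar' f Fh c L \<eta> x0 r0 = deriv Fh (fbar f Fh c L \<eta> x0 r0 + c)"

definition alpha_low ::
  "('a \<Rightarrow> real) \<Rightarrow> (real \<Rightarrow> real) \<Rightarrow> real \<Rightarrow> real \<Rightarrow> real \<Rightarrow> 'a \<Rightarrow> real \<Rightarrow> real" where
  "alpha_low f Fh c L \<eta> x0 r0 = Fbar' f Fh c L \<eta> x0 r0 / Fbar f Fh c L \<eta> x0 r0"

end

theory Submission
  imports Defs
begin

text \<open>
  The energy \<open>r\<close> decreases by \<open>r k - r (Suc k) = \<eta> * r (Suc k) * F'\<^sub>k / F\<^sub>k * \<parallel>\<nabla>f\<parallel>\<^sup>2\<close>, which is exactly
  the first-order decrease of \<open>F\<^sub>k\<close>. Concavity of \<open>Fh\<close> and the descent lemma for \<open>f\<close> therefore give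
  \<open>F\<^sub>k\<^sub>+\<^sub>1 - F\<^sub>k \<le> -(r\<^sub>k - r\<^sub>k\<^sub>+\<^sub>1) + L \<eta> / (2 F\<^sub>k) * r\<^sub>k\<^sub>+\<^sub>1 * (r\<^sub>k - r\<^sub>k\<^sub>+\<^sub>1)\<close>; since
  \<open>2 r\<^sub>k\<^sub>+\<^sub>1 * (r\<^sub>k - r\<^sub>k\<^sub>+\<^sub>1) \<le> r\<^sub>k\<^sup>2 - r\<^sub>k\<^sub>+\<^sub>1\<^sup>2\<close>, the sum telescopes and \<open>F\<^sub>k\<close> never exceeds the
  barrier \<open>Fbar\<close>. As \<open>F'\<close> is decreasing, \<open>F'\<^sub>k / F\<^sub>k\<close> is at least \<open>alpha_low\<close>, so \<open>r\<close> contracts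
  geometrically as long as the gradients stay large.
\<close>

section \<open>Gradients and the descent lemma\<close>

lemma GDERIV_unique:
  assumes "GDERIV f x :> D" "GDERIV f x :> E"
  shows "D = E"
proof -
  have "(\<lambda>h. inner h D) = (\<lambda>h. inner h E)"
    using assms has_derivative_unique unfolding gderiv_def by blast
  then have "inner (D - E) (D - E) = 0"
    by (metis inner_diff_right eq_iff_diff_eq_0)
  then show ?thesis by simp
qed

text \<open>Riesz representation in coordinates: the derivative is linear, hence the inner product
  with the vector whose coordinates are its values on \<open>Basis\<close>. Uniqueness of that
  vector makes the \<open>THE\<close> in \<open>grad\<close> well defined.\<close>

lemma GDERIV_grad:
  fixes f :: "'a::euclidean_space \<Rightarrow> real"
  assumes "f differentiable (at x)"
  shows "GDERIV f x :> grad f x"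
proof -
  obtain f' where f': "(f has_derivative f') (at x)"
    using assms unfolding differentiable_def by blast
  then have lin: "linear f'" by (rule has_derivative_linear)
  have "f' h = inner h (\<Sum>b\<in>Basis. f' b *\<^sub>R b)" for h
  proof -
    have "f' h = f' (\<Sum>b\<in>Basis. inner h b *\<^sub>R b)" by (simp add: euclidean_representation)
    also have "\<dots> = (\<Sum>b\<in>Basis. inner h b * f' b)"
      using lin by (simp add: linear_sum linear_cmul)
    also have "\<dots> = inner h (\<Sum>b\<in>Basis. f' b *\<^sub>R b)"
      by (simp add: inner_sum_right mult.commute)
    finally show ?thesis .
  qed
  then have "f' = (\<lambda>h. inner h (\<Sum>b\<in>Basis. f' b *\<^sub>R b))" by blast
  then have "GDERIV f x :> (\<Sum>b\<in>Basis. f' b *\<^sub>R b)"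
    using f' unfolding gderiv_def by simp
  then show ?thesis
    unfolding grad_def using GDERIV_unique by (blast intro: theI)
qed

text \<open>Along the segment from \<open>a\<close> to \<open>a + v\<close>, the gap between
  \<open>f\<close> and its quadratic upper model has nonpositive derivative, by Cauchy-Schwarz and
  the Lipschitz bound. Monotonicity of this gap takes the place of an integral.\<close>

lemma C11_descent:
  fixes f :: "'a::euclidean_space \<Rightarrow> real"
  assumes "C11 L f"
  shows "f (a + v) \<le> f a + inner (grad f a) v + L / 2 * (norm v)\<^sup>2"
proof -
  define \<phi> where "\<phi> t = f (a + t *\<^sub>R v) - t * inner (grad f a) v - L / 2 * t\<^sup>2 * (norm v)\<^sup>2" for t
  have "\<phi> 1 \<le> \<phi> 0"
  proof (rule DERIV_nonpos_imp_nonincreasing[of 0 1 \<phi>])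
    fix t :: real assume t: "0 \<le> t" "t \<le> 1"
    let ?D = "inner (grad f (a + t *\<^sub>R v)) v - inner (grad f a) v - L * t * (norm v)\<^sup>2"
    have "(f has_derivative (\<lambda>h. inner h (grad f (a + t *\<^sub>R v)))) (at (a + t *\<^sub>R v))"
      using GDERIV_grad assms unfolding C11_def gderiv_def by blast
    moreover have "((\<lambda>t. a + t *\<^sub>R v) has_derivative (\<lambda>h. h *\<^sub>R v)) (at t)"
      by (auto intro!: derivative_eq_intros)
    ultimately have "((\<lambda>t. f (a + t *\<^sub>R v)) has_derivative
        (\<lambda>h. inner (h *\<^sub>R v) (grad f (a + t *\<^sub>R v)))) (at t)"
      by (rule has_derivative_compose[rotated])
    then have "((\<lambda>t. f (a + t *\<^sub>R v)) has_real_derivative inner (grad f (a + t *\<^sub>R v)) v) (at t)"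
      by (simp add: has_field_derivative_def inner_commute mult_commute_abs)
    then have "(\<phi> has_real_derivative ?D) (at t)"
      unfolding \<phi>_def by (auto intro!: derivative_eq_intros)
    moreover have "?D \<le> 0"
    proof -
      have "norm (grad f (a + t *\<^sub>R v) - grad f a) \<le> L * norm (t *\<^sub>R v)"
        using lipschitz_onD[of L UNIV "grad f" "a + t *\<^sub>R v" a] assms
        by (simp add: C11_def dist_norm)
      then have "norm (grad f (a + t *\<^sub>R v) - grad f a) * norm v \<le> L * t * (norm v)\<^sup>2"
        using t mult_right_mono[OF _ norm_ge_zero[of v]] by (force simp: power2_eq_square)
      moreover have "inner (grad f (a + t *\<^sub>R v) - grad f a) v
          \<le> norm (grad f (a + t *\<^sub>R v) - grad f a) * norm v"
        by (rule norm_cauchy_schwarz)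
      ultimately show ?thesis by (simp add: inner_diff_left)
    qed
    ultimately show "\<exists>y. (\<phi> has_real_derivative y) (at t) \<and> y \<le> 0" by blast
  qed simp
  then show ?thesis by (simp add: \<phi>_def)
qed

section \<open>Tangents and derivatives of concave functions\<close>

lemma concave_on_le_tangent:
  fixes F :: "real \<Rightarrow> real"
  assumes "concave_on A F" "open A" "connected A" "F differentiable_on A" "u \<in> A" "v \<in> A"
  shows "F v \<le> F u + deriv F u * (v - u)"
proof -
  \<comment> \<open>Openness of \<open>A\<close> turns the derivative within \<open>A\<close> into
    the full derivative that \<open>deriv\<close> denotes.\<close>
  have "(F has_real_derivative deriv F u) (at u)"
    using differentiable_onD[OF assms(4,5)] at_within_open[OF assms(5,2)]
      DERIV_deriv_iff_real_differentiable by metis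
  then have "((\<lambda>x. - F x) has_real_derivative - deriv F u) (at u within A)"
    by (rule has_field_derivative_at_within[OF DERIV_minus])
  then have "- F v - - F u \<ge> - deriv F u * (v - u)"
    using assms by (intro convex_on_imp_above_tangent[of A])
      (auto simp: concave_on_def interior_open)
  then show ?thesis by simp
qed

lemma concave_on_deriv_antimono:
  fixes F :: "real \<Rightarrow> real"
  assumes "concave_on A F" "open A" "connected A" "F differentiable_on A"
    and "u \<in> A" "v \<in> A" "u \<le> v"
  shows "deriv F v \<le> deriv F u"
proof (cases "u = v")
  case False
  \<comment> \<open>Sum of the tangent inequalities at \<open>u\<close> and at
    \<open>v\<close>.\<close>
  have "(deriv F v - deriv F u) * (v - u) \<le> 0"
    using concave_on_le_tangent[OF assms(1-4), of u v]
      concave_on_le_tangent[OF assms(1-4), of v u] assms(5,6)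
    by (simp add: algebra_simps)
  then show ?thesis using False \<open>u \<le> v\<close> by (simp add: mult_le_0_iff)
qed simp

section \<open>Energy decrease and the barrier for \<open>F\<close>\<close>

locale gAEGD_run =
  fixes f :: "'a::euclidean_space \<Rightarrow> real" and Fh :: "real \<Rightarrow> real"
    and L c \<eta> r0 :: real and x0 :: 'a and x :: "nat \<Rightarrow> 'a" and r :: "nat \<Rightarrow> real"
  assumes C11: "C11 L f"
    and bdd: "bdd_below (range f)"
    and shift: "fstar f + c > 0"
    and Fh_pos: "y > 0 \<Longrightarrow> Fh y > 0"
    and Fh_diff: "Fh differentiable_on {0<..}"
    and Fh_mono: "strict_mono_on {0<..} Fh"
    and Fh'_pos: "y > 0 \<Longrightarrow> deriv Fh y > 0"
    and Fh_concave: "concave_on {0<..} Fh"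
    and r0: "r0 > 0" and \<eta>: "\<eta> > 0"
    and run: "gAEGD f Fh c \<eta> x0 r0 x r"
begin

abbreviation F where "F k \<equiv> Fh (f (x k) + c)"
abbreviation F' where "F' k \<equiv> deriv Fh (f (x k) + c)"
abbreviation G where "G k \<equiv> (norm (grad f (x k)))\<^sup>2"
abbreviation Fb where "Fb \<equiv> Fbar f Fh c L \<eta> x0 r0"
abbreviation alpha where "alpha \<equiv> alpha_low f Fh c L \<eta> x0 r0"

lemma fstar_le: "fstar f \<le> f y"
  unfolding fstar_def using bdd by (rule cINF_lower) simp

lemma shift_pos: "f y + c > 0"
  using fstar_le[of y] shift by linarith

lemma L_nonneg: "L \<ge> 0"
  using C11 unfolding C11_def by (blast dest: lipschitz_on_nonneg)

lemma Fstar_pos: "Fstar f Fh c > 0"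
  unfolding Fstar_def by (rule Fh_pos[OF shift])

lemma Fstar_le: "Fstar f Fh c \<le> F k"
  unfolding Fstar_def using fstar_le[of "x k"] shift shift_pos[of "x k"]
  by (intro strict_mono_on_leD[OF Fh_mono]) auto

text \<open>The update without division: its denominator is at least 1, because \<open>F\<close> and
  \<open>F'\<close> are positive along the run.\<close>

lemma r_decrease:
  "r (Suc k) * (1 + \<eta> * (F' k / F k) * G k) = r k"
proof -
  have "\<eta> * (F' k / F k) * G k \<ge> 0"
    using \<eta> Fh_pos[OF shift_pos, of "x k"] Fh'_pos[OF shift_pos, of "x k"] by simp
  then have "1 + \<eta> * (F' k / F k) * G k \<noteq> 0" by linarith
  moreover have "r (Suc k) = r k / (1 + \<eta> * (F' k / F k) * G k)"
    using run unfolding gAEGD_def by blast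
  ultimately show ?thesis by simp
qed

lemma r_pos: "r k > 0"
proof (induction k)
  case 0
  show ?case using run r0 by (simp add: gAEGD_def)
next
  case (Suc k)
  have "1 + \<eta> * (F' k / F k) * G k > 0"
    using \<eta> Fh_pos[OF shift_pos, of "x k"] Fh'_pos[OF shift_pos, of "x k"]
    by (intro add_pos_nonneg) auto
  then show ?case using r_decrease[of k] Suc by (metis zero_less_mult_pos2)
qed

lemma F_step:
  "F (Suc k) \<le> F k + L * \<eta> / (4 * Fstar f Fh c) * ((r k)\<^sup>2 - (r (Suc k))\<^sup>2)"
proof -
  define s where "s = \<eta> * (r (Suc k) / F k)"
  define d where "d = r k - r (Suc k)"
  have Fk: "F k > 0" by (rule Fh_pos[OF shift_pos])
  have d: "d = s * F' k * G k"
    using r_decrease[of k] unfolding d_def s_def by (simp add: distrib_left mult_ac)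
  have s: "s \<ge> 0" unfolding s_def using \<eta> r_pos[of "Suc k"] Fk by simp
  have d0: "d \<ge> 0" unfolding d using s Fh'_pos[OF shift_pos, of "x k"] by simp
  have "x (Suc k) = x k + - s *\<^sub>R grad f (x k)"
    using run unfolding gAEGD_def s_def by simp
  then have "f (x (Suc k)) \<le> f (x k) + - s * G k + L / 2 * (s\<^sup>2 * G k)"
    using C11_descent[OF C11, of "x k" "- s *\<^sub>R grad f (x k)"]
    by (simp add: power_mult_distrib power2_norm_eq_inner)
  then have "F' k * (f (x (Suc k)) - f (x k)) \<le> F' k * (- s * G k + L / 2 * (s\<^sup>2 * G k))"
    using Fh'_pos[OF shift_pos, of "x k"] by (intro mult_left_mono) auto
  also have "\<dots> = - d + L / 2 * s * d"
    unfolding d by (simp add: algebra_simps power2_eq_square)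
  \<comment> \<open>The first-order gain \<open>- d\<close> is discarded; the barrier only has to
    absorb the second-order error.\<close>
  also have "\<dots> \<le> L / 2 * s * d" using d0 by simp
  \<comment> \<open>Replacing \<open>F k\<close> by its lower bound makes the coefficient
    independent of \<open>k\<close>, so that the estimates telescope.\<close>
  also have "\<dots> \<le> L / 2 * (\<eta> * r (Suc k) / Fstar f Fh c) * d"
    using Fstar_le[of k] Fstar_pos L_nonneg \<eta> r_pos[of "Suc k"] d0 unfolding s_def
    by (intro mult_right_mono mult_left_mono) (auto intro!: divide_left_mono)
  also have "\<dots> = L * \<eta> / (4 * Fstar f Fh c) * (2 * r (Suc k) * d)" by simp
  also have "\<dots> \<le> L * \<eta> / (4 * Fstar f Fh c) * ((r k)\<^sup>2 - (r (Suc k))\<^sup>2)"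
  proof (rule mult_left_mono)
    have "(r k)\<^sup>2 - (r (Suc k))\<^sup>2 - 2 * r (Suc k) * d = d\<^sup>2"
      unfolding d_def by (simp add: power2_eq_square algebra_simps)
    then show "2 * r (Suc k) * d \<le> (r k)\<^sup>2 - (r (Suc k))\<^sup>2"
      using zero_le_power2[of d] by linarith
  qed (use L_nonneg \<eta> Fstar_pos in simp)
  finally have "F' k * (f (x (Suc k)) - f (x k))
    \<le> L * \<eta> / (4 * Fstar f Fh c) * ((r k)\<^sup>2 - (r (Suc k))\<^sup>2)" .
  moreover have "F (Suc k) \<le> F k + F' k * (f (x (Suc k)) - f (x k))"
    using concave_on_le_tangent[OF Fh_concave _ _ Fh_diff,
        of "f (x k) + c" "f (x (Suc k)) + c"] shift_pos
    by simp
  ultimately show ?thesis by linarith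
qed

text \<open>Telescoping \<open>F_step\<close> leaves the difference of the squares of
  \<open>r 0\<close> and \<open>r k\<close>; dropping the latter leaves exactly the excess of
  \<open>Fb\<close> over \<open>F 0\<close>.\<close>

lemma F_le_Fbar: "F k \<le> Fb"
proof -
  let ?K = "L * \<eta> / (4 * Fstar f Fh c)"
  have "F k \<le> F 0 + ?K * ((r 0)\<^sup>2 - (r k)\<^sup>2)"
  proof (induction k)
    case (Suc k)
    then show ?case using F_step[of k] by (simp add: right_diff_distrib)
  qed simp
  moreover have "?K * (r k)\<^sup>2 \<ge> 0" using L_nonneg \<eta> Fstar_pos by simp
  ultimately show ?thesis
    using run unfolding gAEGD_def Fbar_def by (simp add: right_diff_distrib)
qed

section \<open>Geometric decay of \<open>r\<close>\<close>

lemma alpha_bounds: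
  assumes "Fb \<in> Fh ` {0<..}"
  shows "0 < alpha" "alpha \<le> F' k / F k"
proof -
  obtain y where y: "y > 0" "Fh y = Fb" using assms by auto
  have "inj_on Fh {0<..}" using Fh_mono by (rule strict_mono_on_imp_inj_on)
  then have "the_inv_into {0<..} Fh Fb = y"
    using y by (intro the_inv_into_f_eq) auto
  then have alpha: "alpha = deriv Fh y / Fh y"
    using y by (simp add: alpha_low_def Fbar'_def fbar_def)
  show "0 < alpha" unfolding alpha using Fh_pos[of y] Fh'_pos[of y] y(1) by simp
  \<comment> \<open>The barrier is pulled back through \<open>Fh\<close>. Here \<open>y\<close> is
    \<open>fbar + c\<close>, so concavity next compares \<open>F' k\<close> with the derivative at
    the barrier.\<close>
  have "f (x k) + c \<le> y"
  proof (rule ccontr)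
    assume "\<not> f (x k) + c \<le> y"
    then have "Fh y < F k" using y shift_pos by (intro strict_mono_onD[OF Fh_mono]) auto
    then show False using F_le_Fbar[of k] y by simp
  qed
  then have "deriv Fh y \<le> F' k"
    using y shift_pos
    by (intro concave_on_deriv_antimono[OF Fh_concave _ _ Fh_diff]) auto
  then show "alpha \<le> F' k / F k"
    unfolding alpha using F_le_Fbar[of k] y Fh_pos[OF shift_pos, of "x k"]
      Fh'_pos[of y]
    by (intro frac_le) auto
qed

text \<open>Each large gradient makes the update denominator at least
  \<open>1 + alpha * \<eta> * \<epsilon>\<close>. Only indices below \<open>n\<close> occur, since
  \<open>r n\<close> is built from the gradients before step \<open>n\<close>.\<close>

lemma r_geometric:
  assumes "Fb \<in> Fh ` {0<..}" "\<epsilon> > 0" "\<And>k. k < n \<Longrightarrow> G k \<ge> \<epsilon>"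
  shows "r n * (1 + alpha * \<eta> * \<epsilon>) ^ n \<le> r0"
  using assms(3)
proof (induction n)
  case 0
  then show ?case using run by (simp add: gAEGD_def)
next
  case (Suc n)
  let ?q = "1 + alpha * \<eta> * \<epsilon>"
  note al = alpha_bounds[OF assms(1)]
  have "alpha * \<epsilon> \<le> F' n / F n * G n"
    using al(1) al(2)[of n] Suc.prems[of n] assms(2) by (intro mult_mono) auto
  then have "?q \<le> 1 + \<eta> * (F' n / F n) * G n"
    using \<eta> mult_left_mono[of "alpha * \<epsilon>" "F' n / F n * G n" \<eta>] by (simp add: mult_ac)
  then have "r (Suc n) * ?q \<le> r n"
    using r_decrease[of n] mult_left_mono[OF _ less_imp_le[OF r_pos[of "Suc n"]]] by metis
  moreover have "?q ^ n \<ge> 0" using al(1) \<eta> assms(2) by simp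
  ultimately have "r (Suc n) * ?q * ?q ^ n \<le> r n * ?q ^ n" by (rule mult_right_mono)
  also have "\<dots> \<le> r0" using Suc by simp
  finally show ?case by (simp add: mult_ac)
qed

text \<open>The bound on \<open>n\<close> is the logarithmic form of
  \<open>r0 / C \<le> ?q ^ n\<close>. If \<open>r0 \<le> C\<close> the logarithm of the ratio is
  nonpositive, and the same argument applies without a case split.\<close>

lemma r_le_threshold:
  assumes "Fb \<in> Fh ` {0<..}" "\<epsilon> > 0" "C > 0" "\<And>k. k < n \<Longrightarrow> G k \<ge> \<epsilon>"
    and n: "real n \<ge> ln (r0 / C) / ln (1 + alpha * \<eta> * \<epsilon>)"
  shows "r n \<le> C"
proof -
  let ?q = "1 + alpha * \<eta> * \<epsilon>"
  have q: "?q > 1" using alpha_bounds(1)[OF assms(1)] \<eta> \<open>\<epsilon> > 0\<close> by simp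
  have "ln (r0 / C) \<le> real n * ln ?q"
    using n q by (simp add: divide_le_eq)
  also have "\<dots> = ln (?q ^ n)" using q by (simp add: ln_realpow)
  finally have "r0 / C \<le> ?q ^ n" using r0 \<open>C > 0\<close> q by (subst (asm) ln_le_cancel_iff) auto
  then have "r0 \<le> C * ?q ^ n" using \<open>C > 0\<close> by (simp add: field_simps)
  then have "r n * ?q ^ n \<le> C * ?q ^ n"
    using r_geometric[OF assms(1,2), of n] assms(4) by fastforce
  then show ?thesis using q by (simp add: mult_le_cancel_right)
qed

end

theorem lemma3p2:
  fixes f :: "real ^ 'd \<Rightarrow> real" and Fh :: "real \<Rightarrow> real"
    and L c \<eta> r0 \<epsilon> C :: real
    and x0 :: "real ^ 'd" and x :: "nat \<Rightarrow> real ^ 'd" and r :: "nat \<Rightarrow> real" and N :: nat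
  assumes "C11 L f" and "bdd_below (range f)"
    and "fstar f + c > 0"
    and "Fh ` {0<..} \<subseteq> {0<..}"
    and "smooth_on_open {0<..} Fh"
    and "strict_mono_on {0<..} Fh"
    and "\<forall>y>0. deriv Fh y > 0"
    and "concave_on {0<..} Fh"
    and "r0 > 0" and "\<eta> > 0"
    and "gAEGD f Fh c \<eta> x0 r0 x r"
    and "Fbar f Fh c L \<eta> x0 r0 \<in> Fh ` {0<..}"
    and "\<epsilon> > 0" and "C > 0"
    and "real N \<ge> max (ln (r0 / C) / ln (1 + alpha_low f Fh c L \<eta> x0 r0 * \<eta> * \<epsilon>)) 1"
  shows "Min ((\<lambda>k. (norm (grad f (x k)))\<^sup>2) ` {..N}) < \<epsilon> \<or> r N \<le> C"
proof -
  have "Fh differentiable_on {0<..}"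
    using assms(5) unfolding smooth_on_open_def by (metis funpow_0)
  then interpret gAEGD_run f Fh L c \<eta> r0 x0 x r
    using assms by unfold_locales auto
  show ?thesis
  proof (cases "\<exists>k\<le>N. G k < \<epsilon>")
    case True
    then show ?thesis by (subst Min_less_iff) auto
  next
    case False
    \<comment> \<open>If the minimum is not below \<open>\<epsilon>\<close>, all gradients that
      enter \<open>r N\<close> are large.\<close>
    then have "\<And>k. k < N \<Longrightarrow> G k \<ge> \<epsilon>" by (meson less_imp_le not_less)
    then have "r N \<le> C"
      using assms(12-15) by (intro r_le_threshold[of \<epsilon>]) auto
    then show ?thesis ..
  qed
qed

end
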